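(* Let $\epsilon\in\{0,1,-1\}$ and $\delta\in\mathbb{R}$. There exists a constant $C_\epsilon\ge0$, independent of $h$, of the element diameters $h_T$ and of $\kappa$, with $C_\epsilon=0$ if and only if $\epsilon=-1$, such that, setting $\underline{\alpha}_{\epsilon,\delta}:=C_\epsilon h^\delta$, the following holds: if the penalty parameter satisfies $\alpha_0>\underline{\alpha}_{\epsilon,\delta}$, then $\mathcal{B}_h^{(\epsilon)}$ is coercive on $\mathbf{V}_h$ with respect to $\|\cdot\|_*$, namely $$\mathcal{B}_h^{(\epsilon)}(\mathbf{v}_h,\mathbf{v}_h)\ge\frac12\|\mathbf{v}_h\|_*^2\qquad\text{for all }\mathbf{v}_h\in\mathbf{V}_h.$$
   Context: $\Omega\subset\mathbb{R}^d$, $d\ge2$, is a bounded polyhedral domain with Lipschitz boundary; $\kappa\in[L^\infty(\Omega)]^{d\times d}$ is symmetric and uniformly positive definite. Meshes. $\{\mathcal{T}_h\}_{0<h\le1}$ is a shape-regular family of affine (conforming, simplicial) triangulations of $\Omega$; $h_T:=\mathrm{diam}(T)$, $h:=\max_T h_T$; the family is quasi-uniform: there is $0<\rho_0\le1$ independent of $h$ with $\rho_0h\le h_T\le h$ for all $T\in\mathcal{T}_h$. $\kappa|_T=:\kappa_T$ is constant for each $T\in\mathcal{T}_h$. $\mathcal{F}_h$ is the set of all interfaces ($(d-1)$-dimensional faces), $\mathcal{F}_h^b$ the boundary ones, $\mathcal{F}_T:=\{F\in\mathcal{F}_h:F\subset\partial T\}$, and $\mathbf{n}_{T,F}$ is the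 unit normal to $F$ pointing out of $T$. $\nabla_h$ is the broken gradient, $(\cdot,\cdot)_{\mathcal{T}_h}:=\sum_T(\cdot,\cdot)_{L^2(T)}$ with norm $\|\cdot\|_{0,\mathcal{T}_h}$, $\langle\cdot,\cdot\rangle_{\partial\mathcal{T}_h}:=\sum_T\langle\cdot,\cdot\rangle_{L^2(\partial T)}$, $\|\cdot\|_{0,D}$ is the $L^2(D)$ norm. Discrete spaces. $V_h:=\{v_h\in L^2(\Omega):v_h|_T\in\mathbb{P}_k(T)\ \forall T\in\mathcal{T}_h\}$, $\hat V_h:=\{\hat v_h\in L^2(\mathcal{F}_h):\hat v_h|_F\in\mathbb{P}_k(F)\ \forall F\in\mathcal{F}_h,\ \hat v_h|_F=0\ \forall F\in\mathcal{F}_h^b\}$, $\mathbf{V}_h:=V_h\times\hat V_h$, where $\mathbb{P}_k$ denotes polynomials of degree at most $k$. For a pair $\mathbf{v}=(v,\hat v)$ the jump on $F\in\mathcal{F}_T$ is $[\![\mathbf{v}]\!]_{T,F}:=(v|_T|_F-\hat v|_F)\,\mathbf{n}_{T,F}$. Penalty. $C_{tr}>0$ is a constant independent of $h_T$ with $\|p\|_{0,F}\le C_{tr}h_T^{-1/2}\|p\|_{0,T}$ for all $p\in\mathbb{P}_k(T)$, $T\in\mathcal{T}_h$, $F\in\mathcal{F}_T$. On $F\in\mathcal{F}_T$, $\tau$ equals $\tau_{T,F}:=\alpha_0C_{tr}^2\kappa_{T,F}/h_T^{1+\delta}$ with $\kappa_{T,F}:=\mathbf{n}_{T,F}\cdot\kappa_T\mathbf{n}_{T,F}$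 and user-chosen $\alpha_0>0$. Bilinear form. $$\mathcal{B}_h^{(\epsilon)}(\mathbf{w},\mathbf{v}):=(\kappa\nabla_hw,\nabla_hv)_{\mathcal{T}_h}+\langle\tau[\![\mathbf{w}]\!],[\![\mathbf{v}]\!]\rangle_{\partial\mathcal{T}_h}-\langle\kappa\nabla_hw,[\![\mathbf{v}]\!]\rangle_{\partial\mathcal{T}_h}-\epsilon\langle\kappa\nabla_hv,[\![\mathbf{w}]\!]\rangle_{\partial\mathcal{T}_h}.$$ Norm. $\|\mathbf{v}\|_*^2:=\|\kappa^{1/2}\nabla_hv\|_{0,\mathcal{T}_h}^2+\sum_{T}\sum_{F\in\mathcal{F}_T}\|\tau_{T,F}^{1/2}[\![\mathbf{v}]\!]\|_{0,F}^2$. *)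

theory Defs
  imports "HOL-Analysis.Analysis"
begin

text \<open>Domain\<close>

text \<open>Near each boundary point the set is the strict subgraph, in some direction \<open>e\<close>, of a
  Lipschitz function of the component orthogonal to \<open>e\<close>.\<close>

definition lipschitz_boundary :: "'a::euclidean_space set \<Rightarrow> bool" where
  "lipschitz_boundary \<Omega> \<longleftrightarrow>
     (\<forall>x\<in>frontier \<Omega>. \<exists>U e \<phi> L. open U \<and> x \<in> U \<and> norm e = 1 \<and>
        L-lipschitz_on {y. e \<bullet> y = 0} \<phi> \<and>
        \<Omega> \<inter> U = {y \<in> U. e \<bullet> y < \<phi> (y - (e \<bullet> y) *\<^sub>R e)})"

definition polyhedral_lipschitz_domain :: "'a::euclidean_space set \<Rightarrow> bool" where
  "polyhedral_lipschitz_domain \<Omega> \<longleftrightarrow>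
     open \<Omega> \<and> connected \<Omega> \<and> \<Omega> \<noteq> {} \<and> bounded \<Omega> \<and>
     (\<exists>P. finite P \<and> (\<forall>S\<in>P. polytope S) \<and> closure \<Omega> = \<Union>P) \<and>
     lipschitz_boundary \<Omega>"


text \<open>Square integrable functions and surface integrals\<close>

definition L2 :: "'a measure \<Rightarrow> ('a \<Rightarrow> real) set" where
  "L2 M = {f \<in> borel_measurable M. integrable M (\<lambda>x. (f x)\<^sup>2)}"

definition L2_norm :: "'a measure \<Rightarrow> ('a \<Rightarrow> 'b::real_normed_vector) \<Rightarrow> real" where
  "L2_norm M f = sqrt (LINT x|M. (norm (f x))\<^sup>2)"

definition direction_basis :: "'a::euclidean_space set \<Rightarrow> 'a set" where
  "direction_basis F = (SOME B. pairwise orthogonal B \<and> (\<forall>b\<in>B. norm b = 1) \<and>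
     span B = span {x - y | x y. x \<in> F \<and> y \<in> F})"

text \<open>The surface measure on a flat set \<open>F\<close> is the Lebesgue measure of dimension \<open>aff_dim F\<close>,
  carried to the affine hull of \<open>F\<close> by the isometry that an orthonormal basis of its
  direction space defines, and restricted to \<open>F\<close>. It depends neither on the base point nor
  on the basis.\<close>

definition face_measure :: "'a::euclidean_space set \<Rightarrow> 'a measure" where
  "face_measure F = restrict_space
     (completion
       (distr (\<Pi>\<^sub>M b\<in>direction_basis F. lborel) borel
         (\<lambda>t. (SOME a. a \<in> F) + (\<Sum>b\<in>direction_basis F. t b *\<^sub>R b)))) F"


text \<open>Polynomials of total degree at most \<open>k\<close>. The restrictions of these to a hyperplane are
  exactly the polynomials of degree at most \<open>k\<close> on it, so that the same set serves for the
  elements and for their faces.\<close>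

definition polys :: "nat \<Rightarrow> (real^'n \<Rightarrow> real) set" where
  "polys k = {p. \<exists>c :: ('n \<Rightarrow> nat) \<Rightarrow> real.
     \<forall>x. p x = (\<Sum>\<alpha> | sum \<alpha> UNIV \<le> k. c \<alpha> * (\<Prod>i\<in>UNIV. (x $ i) ^ \<alpha> i))}"

definition gradient :: "(real^'n \<Rightarrow> real) \<Rightarrow> real^'n \<Rightarrow> real^'n" where
  "gradient p x = (\<chi> i. frechet_derivative p (at x) (axis i 1))"


text \<open>Meshes\<close>

definition simplicial_mesh :: "(real^'n) set \<Rightarrow> (real^'n) set set \<Rightarrow> bool" where
  "simplicial_mesh \<Omega> M \<longleftrightarrow>
     triangulation M \<and> (\<forall>T\<in>M. int CARD('n) simplex T) \<and> \<Union>M = closure \<Omega>"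

definition shape_regular :: "real set \<Rightarrow> (real \<Rightarrow> (real^'n) set set) \<Rightarrow> bool" where
  "shape_regular H \<T> \<longleftrightarrow>
     (\<exists>\<sigma>>0. \<forall>h\<in>H. \<forall>T\<in>\<T> h. \<exists>x. cball x (\<sigma> * diameter T) \<subseteq> T)"

definition quasi_uniform :: "real \<Rightarrow> real set \<Rightarrow> (real \<Rightarrow> (real^'n) set set) \<Rightarrow> bool" where
  "quasi_uniform \<rho>\<^sub>0 H \<T> \<longleftrightarrow>
     (\<forall>h\<in>H. \<forall>T\<in>\<T> h. \<rho>\<^sub>0 * h \<le> diameter T \<and> diameter T \<le> h)"

text \<open>The index set \<open>H\<close> of mesh sizes may be any part of the interval from 0 to 1: a given
  domain need not have a triangulation of every mesh size in that interval.\<close>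

definition mesh_family :: "(real^'n) set \<Rightarrow> real set \<Rightarrow> (real \<Rightarrow> (real^'n) set set) \<Rightarrow> bool" where
  "mesh_family \<Omega> H \<T> \<longleftrightarrow>
     H \<subseteq> {0<..1} \<and>
     (\<forall>h\<in>H. simplicial_mesh \<Omega> (\<T> h) \<and> h = Max (diameter ` \<T> h)) \<and>
     shape_regular H \<T>"

definition faces :: "(real^'n) set set \<Rightarrow> (real^'n) set set" where
  "faces M = {F. \<exists>T\<in>M. F facet_of T}"

definition boundary_faces :: "(real^'n) set \<Rightarrow> (real^'n) set set \<Rightarrow> (real^'n) set set" where
  "boundary_faces \<Omega> M = {F \<in> faces M. F \<subseteq> frontier \<Omega>}"

definition element_faces :: "(real^'n) set set \<Rightarrow> (real^'n) set \<Rightarrow> (real^'n) set set" where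
  "element_faces M T = {F \<in> faces M. F \<subseteq> frontier T}"

text \<open>There is exactly one such vector when \<open>F\<close> is a facet of a full-dimensional simplex \<open>T\<close>.\<close>

definition outer_normal :: "(real^'n) set \<Rightarrow> (real^'n) set \<Rightarrow> real^'n" where
  "outer_normal T F = (SOME n. norm n = 1 \<and>
     (\<forall>x\<in>F. \<forall>y\<in>F. n \<bullet> (x - y) = 0) \<and> (\<forall>x\<in>T. \<forall>y\<in>F. n \<bullet> (x - y) \<le> 0))"


text \<open>Diffusion tensor\<close>

definition diffusion_tensor :: "(real^'n) set \<Rightarrow> (real^'n \<Rightarrow> real^'n^'n) \<Rightarrow> bool" where
  "diffusion_tensor \<Omega> \<kappa> \<longleftrightarrow>
     \<kappa> \<in> borel_measurable (lebesgue_on \<Omega>) \<and>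
     (\<exists>K. AE x in lebesgue_on \<Omega>. norm (\<kappa> x) \<le> K) \<and>
     (AE x in lebesgue_on \<Omega>. transpose (\<kappa> x) = \<kappa> x) \<and>
     (\<exists>c>0. AE x in lebesgue_on \<Omega>. \<forall>\<xi>. c * (norm \<xi>)\<^sup>2 \<le> \<xi> \<bullet> (\<kappa> x *v \<xi>))"

definition piecewise_constant :: "(real^'n) set set \<Rightarrow> (real^'n \<Rightarrow> real^'n^'n) \<Rightarrow> bool" where
  "piecewise_constant M \<kappa> \<longleftrightarrow> (\<forall>T\<in>M. \<exists>K. AE x in lebesgue_on T. \<kappa> x = K)"

definition element_tensor :: "(real^'n \<Rightarrow> real^'n^'n) \<Rightarrow> (real^'n) set \<Rightarrow> real^'n^'n" where
  "element_tensor \<kappa> T = (SOME K. AE x in lebesgue_on T. \<kappa> x = K)"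

text \<open>The symmetric positive semidefinite square root of a matrix (unique if it exists).\<close>

definition matrix_sqrt :: "real^'n^'n \<Rightarrow> real^'n^'n" where
  "matrix_sqrt A = (SOME B. transpose B = B \<and> (\<forall>x. 0 \<le> x \<bullet> (B *v x)) \<and> B ** B = A)"


text \<open>Discrete spaces. Elements of \<open>L\<^sup>2\<close> are represented by functions that matter only up to
  null sets; all notions below are invariant under changes on null sets. As a mesh has finitely
  many faces, square integrability on the skeleton is square integrability on each face.\<close>

definition V_elem :: "(real^'n) set \<Rightarrow> (real^'n) set set \<Rightarrow> nat \<Rightarrow> (real^'n \<Rightarrow> real) set" where
  "V_elem \<Omega> M k = {v \<in> L2 (lebesgue_on \<Omega>).
     \<forall>T\<in>M. \<exists>p\<in>polys k. AE x in lebesgue_on T. v x = p x}"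

definition V_face :: "(real^'n) set \<Rightarrow> (real^'n) set set \<Rightarrow> nat \<Rightarrow> (real^'n \<Rightarrow> real) set" where
  "V_face \<Omega> M k = {u.
     (\<forall>F\<in>faces M. u \<in> L2 (face_measure F) \<and>
        (\<exists>p\<in>polys k. AE x in face_measure F. u x = p x)) \<and>
     (\<forall>F\<in>boundary_faces \<Omega> M. AE x in face_measure F. u x = 0)}"

definition V_space ::
  "(real^'n) set \<Rightarrow> (real^'n) set set \<Rightarrow> nat \<Rightarrow> ((real^'n \<Rightarrow> real) \<times> (real^'n \<Rightarrow> real)) set" where
  "V_space \<Omega> M k = V_elem \<Omega> M k \<times> V_face \<Omega> M k"

text \<open>The polynomial that represents \<open>v\<close> on the element \<open>T\<close>; it is unique, since \<open>T\<close> has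
  nonempty interior. The trace of \<open>v\<close> on a face of \<open>T\<close> and the broken gradient of \<open>v\<close> on \<open>T\<close>
  are those of this polynomial.\<close>

definition element_poly ::
  "nat \<Rightarrow> (real^'n \<Rightarrow> real) \<Rightarrow> (real^'n) set \<Rightarrow> real^'n \<Rightarrow> real" where
  "element_poly k v T = (SOME p. p \<in> polys k \<and> (AE x in lebesgue_on T. v x = p x))"

definition broken_gradient ::
  "nat \<Rightarrow> (real^'n \<Rightarrow> real) \<Rightarrow> (real^'n) set \<Rightarrow> real^'n \<Rightarrow> real^'n" where
  "broken_gradient k v T = gradient (element_poly k v T)"

definition jump ::
  "nat \<Rightarrow> (real^'n \<Rightarrow> real) \<times> (real^'n \<Rightarrow> real) \<Rightarrow>
   (real^'n) set \<Rightarrow> (real^'n) set \<Rightarrow> real^'n \<Rightarrow> real^'n" where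
  "jump k v T F x = (element_poly k (fst v) T x - snd v x) *\<^sub>R outer_normal T F"


text \<open>Penalty, bilinear form and norm\<close>

definition trace_constant :: "nat \<Rightarrow> (real^'n) set set \<Rightarrow> real \<Rightarrow> bool" where
  "trace_constant k M C\<^sub>t\<^sub>r \<longleftrightarrow>
     (\<forall>T\<in>M. \<forall>F\<in>element_faces M T. \<forall>p\<in>polys k.
        L2_norm (face_measure F) p \<le>
          C\<^sub>t\<^sub>r * diameter T powr (-1/2) * L2_norm (lebesgue_on T) p)"

definition penalty ::
  "real \<Rightarrow> real \<Rightarrow> real \<Rightarrow> (real^'n \<Rightarrow> real^'n^'n) \<Rightarrow> (real^'n) set \<Rightarrow> (real^'n) set \<Rightarrow> real" where
  "penalty \<alpha>\<^sub>0 C\<^sub>t\<^sub>r \<delta> \<kappa> T F =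
     \<alpha>\<^sub>0 * C\<^sub>t\<^sub>r\<^sup>2 * (outer_normal T F \<bullet> (element_tensor \<kappa> T *v outer_normal T F))
       / diameter T powr (1 + \<delta>)"

definition bilinear_form ::
  "nat \<Rightarrow> real \<Rightarrow> real \<Rightarrow> real \<Rightarrow> real \<Rightarrow> (real^'n \<Rightarrow> real^'n^'n) \<Rightarrow> (real^'n) set set \<Rightarrow>
   (real^'n \<Rightarrow> real) \<times> (real^'n \<Rightarrow> real) \<Rightarrow> (real^'n \<Rightarrow> real) \<times> (real^'n \<Rightarrow> real) \<Rightarrow> real" where
  "bilinear_form k \<epsilon> \<alpha>\<^sub>0 C\<^sub>t\<^sub>r \<delta> \<kappa> M w v =
     (\<Sum>T\<in>M. LINT x|lebesgue_on T.
        (\<kappa> x *v broken_gradient k (fst w) T x) \<bullet> broken_gradient k (fst v) T x)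
   + (\<Sum>T\<in>M. \<Sum>F\<in>element_faces M T. LINT x|face_measure F.
        (penalty \<alpha>\<^sub>0 C\<^sub>t\<^sub>r \<delta> \<kappa> T F *\<^sub>R jump k w T F x) \<bullet> jump k v T F x)
   - (\<Sum>T\<in>M. \<Sum>F\<in>element_faces M T. LINT x|face_measure F.
        (element_tensor \<kappa> T *v broken_gradient k (fst w) T x) \<bullet> jump k v T F x)
   - \<epsilon> * (\<Sum>T\<in>M. \<Sum>F\<in>element_faces M T. LINT x|face_measure F.
        (element_tensor \<kappa> T *v broken_gradient k (fst v) T x) \<bullet> jump k w T F x)"

definition star_norm ::
  "nat \<Rightarrow> real \<Rightarrow> real \<Rightarrow> real \<Rightarrow> (real^'n \<Rightarrow> real^'n^'n) \<Rightarrow> (real^'n) set set \<Rightarrow>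
   (real^'n \<Rightarrow> real) \<times> (real^'n \<Rightarrow> real) \<Rightarrow> real" where
  "star_norm k \<alpha>\<^sub>0 C\<^sub>t\<^sub>r \<delta> \<kappa> M v = sqrt
     ((\<Sum>T\<in>M.
        (L2_norm (lebesgue_on T) (\<lambda>x. matrix_sqrt (\<kappa> x) *v broken_gradient k (fst v) T x))\<^sup>2)
    + (\<Sum>T\<in>M. \<Sum>F\<in>element_faces M T.
        (L2_norm (face_measure F)
           (\<lambda>x. sqrt (penalty \<alpha>\<^sub>0 C\<^sub>t\<^sub>r \<delta> \<kappa> T F) *\<^sub>R jump k v T F x))\<^sup>2))"

end

theory Submission
  imports Defs
begin

text \<open>Let \<open>B\<close> be the square root of \<open>\<kappa>\<^sub>T\<close>. Only the coupling term
  \<open>(1 + \<epsilon>) \<langle>\<kappa> \<nabla>v, \<lbrakk>v\<rbrakk>\<rangle>\<close> of the form has no sign. On a face \<open>F\<close> of \<open>T\<close> its integrand is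
  \<open>B \<nabla>v \<cdot> B n\<close> times the scalar jump. Young's inequality splits it into half of the
  penalty term on \<open>F\<close> and a multiple of the square of \<open>B \<nabla>v\<close>. The components of \<open>B \<nabla>v\<close>
  are polynomials, so the discrete trace inequality bounds the integral of this square over \<open>F\<close>
  by the one over \<open>T\<close>, with total factor \<open>(1 + \<epsilon>)\<^sup>2 h\<^sub>T\<^sup>\<delta> / (2 \<alpha>\<^sub>0)\<close>.
  A simplex in dimension \<open>d\<close> has at most \<open>2\<^sup>d\<^sup>+\<^sup>1\<close> faces, and quasi-uniformity compares
  \<open>h\<^sub>T\<^sup>\<delta>\<close> with \<open>h\<^sup>\<delta>\<close>. Hence \<open>C\<^sub>\<epsilon> = (1 + \<epsilon>)\<^sup>2 2\<^sup>d\<^sup>+\<^sup>1 max(1, \<rho>\<^sub>0\<^sup>\<delta>)\<close> suffices.\<close>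

section \<open>The square root of a positive semidefinite matrix\<close>

text \<open>By compactness the quadratic form \<open>x \<bullet> f x\<close> attains its maximum on
  the unit sphere of \<open>S\<close>, and a maximiser is an eigenvector. Working in an invariant
  subspace prepares the induction on dimension below.\<close>

lemma selfadjoint_eigenvector:
  fixes f :: "'a::euclidean_space \<Rightarrow> 'a"
  assumes f: "linear f" and S: "subspace S" "S \<noteq> {0}" "f ` S \<subseteq> S"
    and sym: "\<And>x y. x \<bullet> f y = f x \<bullet> y"
  obtains v c where "v \<in> S" "norm v = 1" "f v = c *\<^sub>R v"
proof -
  let ?K = "S \<inter> sphere 0 1"
  obtain w where w: "w \<in> S" "w \<noteq> 0"
    using S subspace_0 by blast
  have "compact ?K"
    using S(1) by (simp add: closed_subspace closed_Int_compact)
  moreover have "?K \<noteq> {}"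
  proof -
    have "(1 / norm w) *\<^sub>R w \<in> ?K"
      using w S(1) by (auto simp: subspace_scale)
    then show ?thesis by blast
  qed
  moreover have "continuous_on ?K (\<lambda>x. x \<bullet> f x)"
    using f by (intro continuous_on_inner continuous_on_id linear_continuous_on) (simp add: linear_conv_bounded_linear)
  ultimately obtain v where v: "v \<in> ?K" and vmax: "\<And>y. y \<in> ?K \<Longrightarrow> y \<bullet> f y \<le> v \<bullet> f v"
    by (metis continuous_attains_sup)
  define c where "c = v \<bullet> f v"
  have vS: "v \<in> S" and v1: "v \<bullet> v = 1"
    using v by (auto simp: norm_eq_1)
  have quad: "x \<bullet> f x \<le> c * (x \<bullet> x)" if "x \<in> S" for x
  proof (cases "x = 0")
    case False
    have "(1 / norm x) *\<^sub>R x \<in> ?K"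
      using that False S(1) by (auto simp: subspace_scale)
    from vmax[OF this] have "(x \<bullet> f x) / (norm x)\<^sup>2 \<le> c"
      by (simp add: linear_scale[OF f] c_def power2_eq_square)
    then show ?thesis
      using False by (simp add: divide_simps power2_norm_eq_inner)
  qed (simp add: linear_0[OF f])
  \<comment> \<open>The quotient \<open>x \<bullet> f x / x \<bullet> x\<close> is maximal at \<open>v\<close>, so its derivative at \<open>v\<close> vanishes
    in the direction of the residual \<open>y\<close>.\<close>
  define y where "y = f v - c *\<^sub>R v"
  have "y = 0"
  proof -
    have yS: "y \<in> S"
      using vS S by (auto simp: y_def intro!: subspace_diff subspace_scale)
    define b where "b = c * (y \<bullet> y) - y \<bullet> f y"
    \<comment> \<open>Expand \<open>quad\<close> at \<open>v + t *\<^sub>R y\<close>. The terms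
      without \<open>t\<close> cancel because \<open>v\<close> is a unit vector, and by symmetry the
      linear terms combine to \<open>2 * t * (y \<bullet> (f v - c *\<^sub>R v))\<close>.\<close>
    have "2 * t * (y \<bullet> y) \<le> t\<^sup>2 * b" for t
    proof -
      have "v + t *\<^sub>R y \<in> S"
        using vS yS S(1) by (intro subspace_add subspace_scale)
      from quad[OF this] have "(v + t *\<^sub>R y) \<bullet> (f v + t *\<^sub>R f y)
          \<le> c * ((v + t *\<^sub>R y) \<bullet> (v + t *\<^sub>R y))"
        by (simp add: linear_add[OF f] linear_scale[OF f])
      moreover have "v \<bullet> f y = f v \<bullet> y"
        by (rule sym)
      moreover have "y \<bullet> y = y \<bullet> f v - c * (y \<bullet> v)"
        by (simp add: y_def inner_diff_right)
      ultimately show ?thesis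
        using v1 unfolding b_def c_def[symmetric]
        by (simp only: inner_add_left inner_add_right inner_scaleR_left inner_scaleR_right
            inner_commute[of "f v" y] inner_commute[of v y])
          (simp add: algebra_simps power2_eq_square c_def)
    qed
    note ineq = this
    have "y \<bullet> y \<le> 0"
    proof (rule ccontr)
      assume "\<not> ?thesis"
      then have pos: "y \<bullet> y > 0" by (simp only: not_le)
      \<comment> \<open>For small \<open>t\<close> the quadratic right side cannot dominate the
        linear left side. This choice bounds the right side by \<open>t * (y \<bullet> y)\<close>;
        the added 1 keeps the denominator positive when \<open>b\<close> is zero.\<close>
      define t where "t = (y \<bullet> y) / (\<bar>b\<bar> + 1)"
      have t: "t > 0" and tb: "t * (\<bar>b\<bar> + 1) = y \<bullet> y"
        using pos by (simp_all add: t_def add_nonneg_pos)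
      have "2 * t * (y \<bullet> y) \<le> t\<^sup>2 * b" by (rule ineq)
      also have "\<dots> \<le> t * (t * (\<bar>b\<bar> + 1))"
        using t by (simp add: power2_eq_square mult_left_mono mult.assoc)
      also have "\<dots> = t * (y \<bullet> y)" by (simp only: tb)
      finally show False using mult_pos_pos[OF t pos] by linarith
    qed
    then have "y \<bullet> y = 0"
      by (intro antisym inner_ge_zero)
    then show ?thesis
      by (simp only: inner_eq_zero_iff)
  qed
  then have "f v - c *\<^sub>R v = 0" by (simp add: y_def)
  then show thesis
    using that[of v c] vS v by auto
qed

text \<open>Induction on the dimension: split off a unit eigenvector \<open>v\<close>. Symmetry
  gives \<open>v \<bullet> f x = f v \<bullet> x\<close>, so \<open>f\<close> maps the orthogonal
  complement of \<open>v\<close> in \<open>S\<close> into itself.\<close>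

lemma selfadjoint_orthonormal_eigenbasis:
  fixes f :: "'a::euclidean_space \<Rightarrow> 'a"
  assumes f: "linear f" and sym: "\<And>x y. x \<bullet> f y = f x \<bullet> y"
    and "subspace S" "f ` S \<subseteq> S"
  shows "\<exists>B\<subseteq>S. pairwise orthogonal B \<and> (\<forall>b\<in>B. norm b = 1 \<and> (\<exists>c. f b = c *\<^sub>R b)) \<and> span B = S"
  using assms(3,4)
proof (induction "dim S" arbitrary: S rule: less_induct)
  case less
  show ?case
  proof (cases "S = {0}")
    case True
    then show ?thesis by (intro exI[of _ "{}"]) auto
  next
    case False
    then obtain v c where v: "v \<in> S" "norm v = 1" "f v = c *\<^sub>R v"
      using selfadjoint_eigenvector[OF f less.prems(1) False less.prems(2) sym] by metis
    have v1: "v \<bullet> v = 1" using v(2) by (simp add: norm_eq_1)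
    let ?S = "S \<inter> {x. v \<bullet> x = 0}"
    have sub: "subspace ?S"
      by (intro subspace_inter less.prems(1) subspace_hyperplane)
    have "v \<notin> ?S" using v1 by simp
    then have "dim ?S < dim S"
      using v(1) less.prems(1) sub by (intro dim_psubset) (metis span_eq_iff inf_le1 psubsetI)
    moreover have "f ` ?S \<subseteq> ?S"
      using less.prems(2) by (auto simp: sym v(3))
    ultimately obtain B where B: "B \<subseteq> ?S" "pairwise orthogonal B"
      "\<forall>b\<in>B. norm b = 1 \<and> (\<exists>c. f b = c *\<^sub>R b)" "span B = ?S"
      using less.hyps[OF _ sub] by blast
    have "S \<subseteq> span (insert v B)"
    proof
      fix x assume x: "x \<in> S"
      have "x - (v \<bullet> x) *\<^sub>R v \<in> ?S"
        using x v v1 less.prems(1) by (auto simp: inner_diff_right intro!: subspace_diff subspace_scale)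
      then have "x - (v \<bullet> x) *\<^sub>R v \<in> span B" using B(4) by simp
      then show "x \<in> span (insert v B)" by (auto simp: span_insert)
    qed
    moreover have "span (insert v B) \<subseteq> S"
      using v(1) B(1) less.prems(1) by (intro span_minimal) auto
    ultimately have "span (insert v B) = S" by blast
    moreover have "pairwise orthogonal (insert v B)"
      using B(1,2) by (auto simp: pairwise_insert orthogonal_def inner_commute)
    ultimately show ?thesis
      using v B(1,3) by (intro exI[of _ "insert v B"]) auto
  qed
qed

text \<open>The root acts on an orthonormal eigenbasis of \<open>A\<close> by the square roots of
  the eigenvalues. Existence is what gives the choice in \<open>matrix_sqrt\<close> its defining
  properties.\<close>

lemma psd_matrix_sqrt_exists:
  fixes A :: "real^'n^'n"
  assumes sym: "transpose A = A" and pos: "\<And>x. 0 \<le> x \<bullet> (A *v x)"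
  shows "\<exists>B. transpose B = B \<and> (\<forall>x. 0 \<le> x \<bullet> (B *v x)) \<and> B ** B = A"
proof -
  have "x \<bullet> (A *v y) = (A *v x) \<bullet> y" for x y
    using sym by (metis dot_lmul_matrix vector_transpose_matrix)
  from selfadjoint_orthonormal_eigenbasis[OF matrix_vector_mul_linear this subspace_UNIV]
  obtain S where S: "pairwise orthogonal S" "\<forall>b\<in>S. norm b = 1 \<and> (\<exists>c. A *v b = c *\<^sub>R b)"
    "span S = UNIV" by auto
  have fin: "finite S" using S(1) by (rule pairwise_orthogonal_imp_finite)
  \<comment> \<open>At a unit eigenvector \<open>b\<close> the value
    \<open>b \<bullet> (A *v b)\<close> is the eigenvalue, which is nonnegative by
    \<open>pos\<close>.\<close>
  define l where "l b = sqrt (b \<bullet> (A *v b))" for b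
  have eig: "A *v b = (l b)\<^sup>2 *\<^sub>R b" if b: "b \<in> S" for b
  proof -
    obtain c where "A *v b = c *\<^sub>R b" "b \<bullet> b = 1" using b S(2) norm_eq_1 by blast
    then show ?thesis using pos[of b] by (simp add: l_def)
  qed
  define g where "g x = (\<Sum>b\<in>S. (l b * (b \<bullet> x)) *\<^sub>R b)" for x
  have g: "linear g"
    unfolding g_def
    by (intro linearI) (simp_all add: inner_add_right algebra_simps sum.distrib scaleR_sum_right)
  have orth: "b \<bullet> b' = (if b = b' then 1 else 0)" if "b \<in> S" "b' \<in> S" for b b'
    using that S by (auto simp: pairwise_def orthogonal_def norm_eq_1)
  have gb: "g b = l b *\<^sub>R b" if "b \<in> S" for b
  proof -
    have "g b = (\<Sum>b'\<in>S. if b' = b then l b *\<^sub>R b else 0)"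
      unfolding g_def using that orth by (intro sum.cong) auto
    then show ?thesis using that fin by (simp add: sum.delta)
  qed
  have "matrix g ** matrix g = A"
  proof -
    have "g (g x) = A *v x" for x
    proof (rule linear_eq_on_span[of "\<lambda>x. g (g x)" "\<lambda>x. A *v x" S])
      show "linear (\<lambda>x. g (g x))" using linear_compose[OF g g] by (simp add: o_def)
    qed (auto simp: gb eig linear_scale[OF g] power2_eq_square S(3))
    then have "(matrix g ** matrix g) *v x = A *v x" for x
      using g by (simp add: matrix_vector_mul_assoc[symmetric])
    then show ?thesis by (simp add: matrix_eq)
  qed
  moreover have gv: "matrix g *v x = g x" for x
    using g by simp
  moreover have "transpose (matrix g) = matrix g"
  proof -
    have "x \<bullet> g y = g x \<bullet> y" for x y
      by (simp add: g_def inner_sum_left inner_sum_right inner_commute mult_ac)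
    then have "x \<bullet> (transpose (matrix g) *v y) = x \<bullet> (matrix g *v y)" for x y
      by (metis gv dot_lmul_matrix vector_transpose_matrix transpose_transpose)
    then show ?thesis
      unfolding matrix_eq by (metis vector_eq_ldot)
  qed
  moreover have "0 \<le> x \<bullet> g x" for x
  proof -
    have "x \<bullet> g x = (\<Sum>b\<in>S. l b * (b \<bullet> x)\<^sup>2)"
      by (simp add: g_def inner_sum_right power2_eq_square inner_commute mult_ac)
    also have "\<dots> \<ge> 0" unfolding l_def using pos by (intro sum_nonneg) simp
    finally show ?thesis .
  qed
  ultimately show ?thesis by metis
qed

lemma matrix_sqrt_psd:
  fixes A :: "real^'n^'n"
  assumes "transpose A = A" and "\<And>x. 0 \<le> x \<bullet> (A *v x)"
  shows "transpose (matrix_sqrt A) = matrix_sqrt A" and "matrix_sqrt A ** matrix_sqrt A = A"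
  using someI_ex[OF psd_matrix_sqrt_exists[OF assms]] by (auto simp: matrix_sqrt_def)

text \<open>One symmetric factor moves across the inner product and meets the other. The product
  weighted with \<open>A\<close> thus becomes Euclidean, which serves both Young's inequality and
  the match of the volume terms in form and norm.\<close>

lemma inner_matrix_sqrt:
  fixes A :: "real^'n^'n"
  assumes "transpose A = A" and "\<And>x. 0 \<le> x \<bullet> (A *v x)"
  shows "(matrix_sqrt A *v x) \<bullet> (matrix_sqrt A *v y) = (A *v x) \<bullet> y"
proof -
  have "(matrix_sqrt A *v x) \<bullet> (matrix_sqrt A *v y) = (transpose (matrix_sqrt A) *v (matrix_sqrt A *v x)) \<bullet> y"
    by (metis dot_lmul_matrix vector_transpose_matrix transpose_transpose)
  then show ?thesis
    using matrix_sqrt_psd[OF assms] by (simp add: matrix_vector_mul_assoc)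
qed

section \<open>Polynomials\<close>

text \<open>Each entry is bounded by the total degree. Finiteness keeps the sum in
  \<open>polys\<close> from collapsing to the default value 0.\<close>

lemma finite_multi_indices: "finite {\<alpha> :: 'n::finite \<Rightarrow> nat. sum \<alpha> UNIV \<le> k}"
proof (rule finite_subset)
  show "{\<alpha> :: 'n \<Rightarrow> nat. sum \<alpha> UNIV \<le> k} \<subseteq> PiE UNIV (\<lambda>_. {..k})"
  proof
    fix \<alpha> :: "'n \<Rightarrow> nat" assume "\<alpha> \<in> {\<alpha>. sum \<alpha> UNIV \<le> k}"
    then have "\<alpha> i \<le> k" for i
      using member_le_sum[of i UNIV \<alpha>] by simp
    then show "\<alpha> \<in> PiE UNIV (\<lambda>_. {..k})"
      by (simp add: PiE_UNIV_domain)
  qed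
qed (simp add: finite_PiE)

lemma monomial_in_polys:
  assumes "sum \<alpha> UNIV \<le> k"
  shows "(\<lambda>x::real^'n. \<Prod>i\<in>UNIV. (x $ i) ^ \<alpha> i) \<in> polys k"
proof -
  have "(\<Prod>i\<in>UNIV. (x $ i) ^ \<alpha> i) =
    (\<Sum>\<beta> | sum \<beta> UNIV \<le> k. (if \<beta> = \<alpha> then 1 else 0) * (\<Prod>i\<in>UNIV. (x $ i) ^ \<beta> i))" for x :: "real^'n"
  proof -
    have "(\<Sum>\<beta> | sum \<beta> UNIV \<le> k. (if \<beta> = \<alpha> then 1 else 0) * (\<Prod>i\<in>UNIV. (x $ i) ^ \<beta> i))
      = (\<Sum>\<beta> | sum \<beta> UNIV \<le> k. if \<beta> = \<alpha> then \<Prod>i\<in>UNIV. (x $ i) ^ \<beta> i else 0)"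
      by (rule sum.cong) auto
    also have "\<dots> = (\<Prod>i\<in>UNIV. (x $ i) ^ \<alpha> i)"
      using assms by (subst sum.delta[OF finite_multi_indices]) simp
    finally show ?thesis ..
  qed
  then show ?thesis
    unfolding polys_def mem_Collect_eq by (intro exI allI)
qed

lemma zero_in_polys: "(\<lambda>x. 0) \<in> polys k"
  by (auto simp: polys_def intro!: exI[of _ "\<lambda>_. 0"])

lemma add_in_polys:
  assumes "p \<in> polys k" "q \<in> polys k"
  shows "(\<lambda>x. p x + q x) \<in> polys k"
proof -
  obtain c d where "\<forall>x. p x = (\<Sum>\<alpha> | sum \<alpha> UNIV \<le> k. c \<alpha> * (\<Prod>i\<in>UNIV. (x $ i) ^ \<alpha> i))"
    and "\<forall>x. q x = (\<Sum>\<alpha> | sum \<alpha> UNIV \<le> k. d \<alpha> * (\<Prod>i\<in>UNIV. (x $ i) ^ \<alpha> i))"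
    using assms by (auto simp: polys_def)
  then have "\<forall>x. p x + q x = (\<Sum>\<alpha> | sum \<alpha> UNIV \<le> k. (c \<alpha> + d \<alpha>) * (\<Prod>i\<in>UNIV. (x $ i) ^ \<alpha> i))"
    by (simp add: distrib_right sum.distrib)
  then show ?thesis
    unfolding polys_def mem_Collect_eq by (intro exI[of _ "\<lambda>\<alpha>. c \<alpha> + d \<alpha>"])
qed

lemma cmult_in_polys:
  assumes "p \<in> polys k"
  shows "(\<lambda>x. a * p x) \<in> polys k"
proof -
  obtain c where "\<forall>x. p x = (\<Sum>\<alpha> | sum \<alpha> UNIV \<le> k. c \<alpha> * (\<Prod>i\<in>UNIV. (x $ i) ^ \<alpha> i))"
    using assms by (auto simp: polys_def)
  then have "\<forall>x. a * p x = (\<Sum>\<alpha> | sum \<alpha> UNIV \<le> k. (a * c \<alpha>) * (\<Prod>i\<in>UNIV. (x $ i) ^ \<alpha> i))"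
    by (simp add: sum_distrib_left mult.assoc)
  then show ?thesis
    unfolding polys_def mem_Collect_eq by (intro exI[of _ "\<lambda>\<alpha>. a * c \<alpha>"])
qed

lemma sum_in_polys:
  assumes "finite I" "\<And>i. i \<in> I \<Longrightarrow> p i \<in> polys k"
  shows "(\<lambda>x. \<Sum>i\<in>I. p i x) \<in> polys k"
  using assms
proof (induction I rule: finite_induct)
  case (insert i I)
  then show ?case
    using add_in_polys[of "p i" k "\<lambda>x. \<Sum>i\<in>I. p i x"] by simp
qed (simp add: zero_in_polys)

lemma continuous_on_polys:
  assumes "p \<in> polys k"
  shows "continuous_on S p"
proof -
  obtain c where "\<forall>x. p x = (\<Sum>\<alpha> | sum \<alpha> UNIV \<le> k. c \<alpha> * (\<Prod>i\<in>UNIV. (x $ i) ^ \<alpha> i))"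
    using assms by (auto simp: polys_def)
  then have "p = (\<lambda>x. \<Sum>\<alpha> | sum \<alpha> UNIV \<le> k. c \<alpha> * (\<Prod>i\<in>UNIV. (x $ i) ^ \<alpha> i))"
    by (intro ext) blast
  moreover have "continuous_on S (\<lambda>x. \<Sum>\<alpha> | sum \<alpha> UNIV \<le> k. c \<alpha> * (\<Prod>i\<in>UNIV. (x $ i) ^ \<alpha> i))"
    by (intro continuous_intros)
  ultimately show ?thesis by (simp only:)
qed

text \<open>Differentiating a monomial lowers one exponent at a time, so no degree rises. Membership
  in the same \<open>polys k\<close> is the form in which the trace inequality applies to
  derivatives.\<close>

lemma has_derivative_polys:
  fixes p :: "real^'n \<Rightarrow> real"
  assumes "p \<in> polys k"
  shows "\<exists>p'. (\<forall>x. (p has_derivative p' x) (at x)) \<and> (\<forall>v. (\<lambda>x. p' x v) \<in> polys k)"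
proof -
  obtain c where c: "\<forall>x. p x = (\<Sum>\<alpha> | sum \<alpha> UNIV \<le> k. c \<alpha> * (\<Prod>i\<in>UNIV. (x $ i) ^ \<alpha> i))"
    using assms by (auto simp: polys_def)
  \<comment> \<open>Subtraction is truncated: for \<open>\<alpha> j = 0\<close> the exponent stays
    0, and the factor \<open>of_nat (\<alpha> j)\<close> removes the term.\<close>
  define D where "D \<alpha> x v = (\<Sum>j\<in>UNIV. (v $ j * of_nat (\<alpha> j)) * (\<Prod>i\<in>UNIV. (x $ i) ^ (\<alpha>(j := \<alpha> j - 1)) i))"
    for \<alpha> :: "'n \<Rightarrow> nat" and x v :: "real^'n"
  have D: "((\<lambda>x. \<Prod>i\<in>UNIV. (x $ i) ^ \<alpha> i) has_derivative D \<alpha> x) (at x)" for \<alpha> x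
  proof -
    have nth: "((\<lambda>x::real^'n. x $ i) has_derivative (\<lambda>v. v $ i)) (at x)" for i
      by (rule bounded_linear.has_derivative[OF bounded_linear_vec_nth has_derivative_ident])
    have "((\<lambda>x. (x $ i) ^ \<alpha> i) has_derivative
        (\<lambda>v. of_nat (\<alpha> i) * v $ i * (x $ i) ^ (\<alpha> i - 1))) (at x)" for i
      using has_derivative_power[OF nth, where n = "\<alpha> i"] by (simp add: mult_ac)
    note deriv = has_derivative_prod[OF this, where I = UNIV]
    have eq: "(\<lambda>v. \<Sum>j\<in>UNIV. of_nat (\<alpha> j) * v $ j * (x $ j) ^ (\<alpha> j - 1) * (\<Prod>i\<in>UNIV - {j}. (x $ i) ^ \<alpha> i))
        = D \<alpha> x"
    proof
      fix v :: "real^'n"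
      show "(\<Sum>j\<in>UNIV. of_nat (\<alpha> j) * v $ j * (x $ j) ^ (\<alpha> j - 1) * (\<Prod>i\<in>UNIV - {j}. (x $ i) ^ \<alpha> i)) = D \<alpha> x v"
        unfolding D_def
      proof (rule sum.cong)
        fix j :: 'n
        have "(\<Prod>i\<in>UNIV. (x $ i) ^ (\<alpha>(j := \<alpha> j - 1)) i) = (x $ j) ^ (\<alpha> j - 1) * (\<Prod>i\<in>UNIV - {j}. (x $ i) ^ \<alpha> i)"
          unfolding prod.remove[OF finite UNIV_I[of j]]
          by (intro arg_cong2[where f="(*)"] prod.cong refl) auto
        then show "of_nat (\<alpha> j) * v $ j * (x $ j) ^ (\<alpha> j - 1) * (\<Prod>i\<in>UNIV - {j}. (x $ i) ^ \<alpha> i)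
          = v $ j * of_nat (\<alpha> j) * (\<Prod>i\<in>UNIV. (x $ i) ^ (\<alpha>(j := \<alpha> j - 1)) i)"
          by (simp only: mult_ac)
      qed simp
    qed
    show ?thesis using deriv[of "\<lambda>i. i"] unfolding eq .
  qed
  have Dpoly: "(\<lambda>x. D \<alpha> x v) \<in> polys k" if "sum \<alpha> UNIV \<le> k" for \<alpha> v
    unfolding D_def
  proof (intro sum_in_polys cmult_in_polys monomial_in_polys)
    fix j
    have "sum (\<alpha>(j := \<alpha> j - 1)) UNIV \<le> sum \<alpha> UNIV" by (intro sum_mono) auto
    then show "sum (\<alpha>(j := \<alpha> j - 1)) UNIV \<le> k" using that by simp
  qed simp
  have "p = (\<lambda>x. \<Sum>\<alpha> | sum \<alpha> UNIV \<le> k. c \<alpha> * (\<Prod>i\<in>UNIV. (x $ i) ^ \<alpha> i))"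
    using c by (intro ext) blast
  moreover have "((\<lambda>x. \<Sum>\<alpha> | sum \<alpha> UNIV \<le> k. c \<alpha> * (\<Prod>i\<in>UNIV. (x $ i) ^ \<alpha> i))
      has_derivative (\<lambda>v. \<Sum>\<alpha> | sum \<alpha> UNIV \<le> k. c \<alpha> * D \<alpha> x v)) (at x)" for x
    by (intro has_derivative_sum has_derivative_mult_right D)
  ultimately have "(p has_derivative (\<lambda>v. \<Sum>\<alpha> | sum \<alpha> UNIV \<le> k. c \<alpha> * D \<alpha> x v)) (at x)" for x
    by (simp only:)
  moreover have "(\<lambda>x. \<Sum>\<alpha> | sum \<alpha> UNIV \<le> k. c \<alpha> * D \<alpha> x v) \<in> polys k" for v
    by (intro sum_in_polys finite_multi_indices cmult_in_polys Dpoly) simp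
  ultimately show ?thesis
    by (rule_tac x = "\<lambda>x v. \<Sum>\<alpha> | sum \<alpha> UNIV \<le> k. c \<alpha> * D \<alpha> x v" in exI) simp
qed

lemma gradient_in_polys:
  assumes "p \<in> polys k"
  shows "(\<lambda>x. gradient p x $ i) \<in> polys k"
proof -
  obtain p' where p': "\<And>x. (p has_derivative p' x) (at x)" "\<And>v. (\<lambda>x. p' x v) \<in> polys k"
    using has_derivative_polys[OF assms] by blast
  then have "frechet_derivative p (at x) = p' x" for x
    by (intro frechet_derivative_at[symmetric])
  then show ?thesis
    using p'(2) by (simp add: gradient_def)
qed

section \<open>The surface measure\<close>

lemma direction_basis:
  fixes F :: "'a::euclidean_space set"
  shows "pairwise orthogonal (direction_basis F)" "\<And>b. b \<in> direction_basis F \<Longrightarrow> norm b = 1"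
    "finite (direction_basis F)"
proof -
  have "\<exists>B. pairwise orthogonal B \<and> (\<forall>b\<in>B. norm b = 1) \<and>
     span B = span {x - y | x y. x \<in> F \<and> y \<in> F}"
    by (rule orthonormal_basis_subspace[OF subspace_span[of "{x - y | x y. x \<in> F \<and> y \<in> F}"]]) blast
  from someI_ex[OF this]
  show *: "pairwise orthogonal (direction_basis F)" "\<And>b. b \<in> direction_basis F \<Longrightarrow> norm b = 1"
    unfolding direction_basis_def by blast+
  show "finite (direction_basis F)"
    by (rule pairwise_orthogonal_imp_finite[OF *(1)])
qed

lemma space_face_measure [simp]: "space (face_measure F) = F"
  by (simp add: face_measure_def space_restrict_space)

lemma borel_measurable_face_measure:
  "f \<in> borel_measurable borel \<Longrightarrow> f \<in> borel_measurable (face_measure F)"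
  unfolding face_measure_def
  by (intro measurable_restrict_space1 measurable_completion) simp

text \<open>In an orthonormal basis each coordinate is bounded by the distance from the base point.
  The parameters of a bounded set therefore lie in a cube, whose Lebesgue measure is finite.\<close>

lemma finite_face_measure:
  fixes F :: "'a::euclidean_space set"
  assumes F: "compact F"
  shows "finite_measure (face_measure F)"
proof
  define B where "B = direction_basis F"
  define a where "a = (SOME a. a \<in> F)"
  define P where "P = (\<Pi>\<^sub>M b\<in>B. lborel :: real measure)"
  define f where "f = (\<lambda>t. a + (\<Sum>b\<in>B. t b *\<^sub>R b))"
  have B: "pairwise orthogonal B" "\<And>b. b \<in> B \<Longrightarrow> norm b = 1" "finite B"
    unfolding B_def by (fact direction_basis)+
  interpret product_sigma_finite "\<lambda>_. lborel :: real measure" by standard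
  have f: "f \<in> P \<rightarrow>\<^sub>M borel"
    unfolding f_def P_def by measurable
  obtain R where R: "\<And>x. x \<in> F \<Longrightarrow> dist a x \<le> R"
    using compact_imp_bounded[OF F] bounded_any_center[of F a] by auto
  have "f -` F \<inter> space P \<subseteq> Pi\<^sub>E B (\<lambda>_. {-R..R})"
  proof
    fix t assume t: "t \<in> f -` F \<inter> space P"
    have "t b \<in> {-R..R}" if b: "b \<in> B" for b
    proof -
      have orth: "b' \<bullet> b = (if b' = b then 1 else 0)" if "b' \<in> B" for b'
        using that b B(1,2) by (auto simp: pairwise_def orthogonal_def norm_eq_1)
      have "(f t - a) \<bullet> b = (\<Sum>b'\<in>B. t b' * (b' \<bullet> b))"
        by (simp add: f_def inner_sum_left)
      also have "\<dots> = (\<Sum>b'\<in>B. if b' = b then t b' else 0)"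
        using orth by (intro sum.cong) auto
      also have "\<dots> = t b" using b B(3) by simp
      finally have "\<bar>t b\<bar> \<le> norm (f t - a)"
        using Cauchy_Schwarz_ineq2[of "f t - a" b] B(2)[OF b] by simp
      also have "\<dots> \<le> R" using R[of "f t"] t by (simp add: dist_norm norm_minus_commute)
      finally show ?thesis by auto
    qed
    moreover have "t \<in> extensional B"
      using t by (auto simp: P_def space_PiM PiE_def)
    ultimately show "t \<in> Pi\<^sub>E B (\<lambda>_. {-R..R})" by (auto simp: PiE_def)
  qed
  then have "emeasure P (f -` F \<inter> space P) \<le> emeasure P (Pi\<^sub>E B (\<lambda>_. {-R..R}))"
    using B(3) by (intro emeasure_mono) (auto simp: P_def intro!: sets_PiM_I_finite)
  also have "\<dots> = (\<Prod>b\<in>B. emeasure lborel {-R..R})"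
    unfolding P_def using B(3) by (intro emeasure_PiM) auto
  also have "\<dots> < \<infinity>"
    \<comment> \<open>For negative \<open>R\<close> the interval is empty and each factor is
      zero.\<close>
    by (cases "-R \<le> R") (auto simp: ennreal_power[symmetric] less_top power_less_top_ennreal)
  finally have fin: "emeasure P (f -` F \<inter> space P) < \<infinity>" .
  have Fb: "F \<in> sets borel" using F by (simp add: borel_compact)
  have "emeasure (face_measure F) F = emeasure (completion (distr P borel f)) F"
    unfolding face_measure_def P_def f_def a_def B_def
    using Fb by (intro emeasure_restrict_space) (auto intro: sets_completionI_sets)
  also have "\<dots> = emeasure (distr P borel f) F"
    using Fb by (simp add: emeasure_completion main_part)
  also have "\<dots> = emeasure P (f -` F \<inter> space P)"
    by (rule emeasure_distr[OF f Fb])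
  finally show "emeasure (face_measure F) (space (face_measure F)) \<noteq> \<infinity>"
    using fin by simp
qed

lemma integrable_face_measure_continuous:
  fixes f :: "'a::euclidean_space \<Rightarrow> real"
  assumes F: "compact F" and f: "continuous_on UNIV f"
  shows "integrable (face_measure F) f"
proof -
  interpret finite_measure "face_measure F" by (rule finite_face_measure[OF F])
  have "compact (f ` F)"
    using F f by (meson compact_continuous_image continuous_on_subset subset_UNIV)
  then obtain C where "\<And>x. x \<in> F \<Longrightarrow> norm (f x) \<le> C"
    by (metis compact_imp_bounded bounded_iff imageI)
  then show ?thesis
    using f by (intro integrable_const_bound[of _ C] AE_I2 borel_measurable_face_measure
        borel_measurable_continuous_onI) auto
qed

section \<open>Faces of a simplicial mesh\<close>

lemma interior_full_simplex_nonempty: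
  fixes T :: "(real^'n) set"
  assumes "int CARD('n) simplex T"
  shows "interior T \<noteq> {}"
proof -
  have "aff_dim T = int DIM(real^'n)" "convex T"
    using assms by (simp_all add: aff_dim_simplex convex_simplex)
  moreover have "T \<noteq> {}"
    using assms by auto
  ultimately show ?thesis
    by (simp add: interior_rel_interior_gen rel_interior_eq_empty)
qed

text \<open>By definition such an \<open>F\<close> is only known to be a facet of some element
  \<open>T'\<close> and to lie in the frontier of \<open>T\<close>. Conformity closes the gap:
  \<open>T \<inter> T'\<close> is a face of both elements and contains \<open>F\<close>.\<close>

lemma element_faces_facet_of:
  fixes M :: "(real^'n) set set"
  assumes M: "simplicial_mesh \<Omega> M" and T: "T \<in> M" and F: "F \<in> element_faces M T"
  shows "F facet_of T"
proof -
  obtain T' where T': "T' \<in> M" "F facet_of T'" and FT: "F \<subseteq> frontier T"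
    using F by (auto simp: element_faces_def faces_def)
  have simpl: "int CARD('n) simplex T" "int CARD('n) simplex T'"
    using M T T' by (auto simp: simplicial_mesh_def)
  note cv = simpl[THEN convex_simplex] and dim = simpl[THEN aff_dim_simplex]
  have face: "T \<inter> T' face_of T" "T \<inter> T' face_of T'"
    using M T T'(1) by (auto simp: simplicial_mesh_def triangulation_def) (metis Int_commute)
  have "frontier T \<subseteq> T"
    using simpl(1) by (simp add: closed_simplex frontier_subset_closed)
  then have sub: "F \<subseteq> T \<inter> T'"
    using FT T'(2) facet_of_imp_subset by blast
  show ?thesis
  proof (cases "T \<inter> T' = T")
    case True
    then have "T' = T"
      using face(2) face_of_aff_dim_lt[OF cv(2) face(2)] dim by auto
    then show ?thesis using T'(2) by simp
  next
    case False
    have "F face_of T \<inter> T'"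
      using T'(2) sub by (meson face_of_subset facet_of_imp_face_of inf_le2)
    moreover have "aff_dim (T \<inter> T') < aff_dim T"
      by (rule face_of_aff_dim_lt[OF cv(1) face(1) False])
    \<comment> \<open>The common face has dimension at most one less than \<open>T\<close>, which is
      already the dimension of its face \<open>F\<close>. A proper face would have smaller
      dimension.\<close>
    ultimately have "F = T \<inter> T'"
      using face_of_aff_dim_lt[of "T \<inter> T'" F] cv T'(2) dim
      by (auto simp: facet_of_def convex_Int)
    then show ?thesis
      using face(1) T'(2) dim by (simp add: facet_of_def)
  qed
qed

text \<open>Faces of a simplex are hulls of subsets of its vertices. Counting all subsets is crude,
  but gives a bound that depends on the dimension alone.\<close>

lemma card_facets_simplex:
  fixes T :: "(real^'n) set"
  assumes "int CARD('n) simplex T"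
  shows "finite {F. F facet_of T}" "card {F. F facet_of T} \<le> 2 ^ (CARD('n) + 1)"
proof -
  obtain C where C: "\<not> affine_dependent C" "int (card C) = int CARD('n) + 1" "T = convex hull C"
    using assms by (auto simp: simplex_def)
  have fin: "finite C" using C(1) by (rule aff_independent_finite)
  have sub: "{F. F facet_of T} \<subseteq> (\<lambda>c. convex hull c) ` Pow C"
    using face_of_convex_hull_affine_independent[OF C(1)] C(3) by (auto simp: facet_of_def)
  show "finite {F. F facet_of T}"
    using sub fin by (meson finite_Pow_iff finite_imageI finite_subset)
  have "card {F. F facet_of T} \<le> card (Pow C)"
    using sub fin by (meson card_image_le card_mono finite_Pow_iff finite_imageI le_trans)
  also have "card C = CARD('n) + 1" using C(2) by linarith
  then have "card (Pow C) = 2 ^ (CARD('n) + 1)" using fin by (simp add: card_Pow)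
  finally show "card {F. F facet_of T} \<le> 2 ^ (CARD('n) + 1)" .
qed

lemma card_element_faces:
  fixes M :: "(real^'n) set set"
  assumes "simplicial_mesh \<Omega> M" and "T \<in> M"
  shows "card (element_faces M T) \<le> 2 ^ (CARD('n) + 1)"
proof -
  have T: "int CARD('n) simplex T" using assms by (simp add: simplicial_mesh_def)
  have "element_faces M T \<subseteq> {F. F facet_of T}"
    using element_faces_facet_of[OF assms] by blast
  then show ?thesis
    using card_facets_simplex[OF T] by (meson card_mono le_trans)
qed

text \<open>A facet of a polyhedron is cut out by a supporting hyperplane, whose normalised normal
  is a witness for the choice in \<open>outer_normal\<close>.\<close>

lemma norm_outer_normal:
  fixes T :: "(real^'n) set"
  assumes T: "polyhedron T" and F: "F facet_of T"
  shows "norm (outer_normal T F) = 1"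
proof -
  have "F exposed_face_of T" "F \<noteq> {}" "F \<noteq> T"
    using assms by (auto simp: exposed_face_of_polyhedron facet_of_def)
  then obtain a b where a: "a \<noteq> 0" "T \<subseteq> {x. a \<bullet> x \<le> b}" "F = T \<inter> {x. a \<bullet> x = b}"
    by (auto simp: exposed_face_of)
  have "\<exists>n. norm n = 1 \<and>
     (\<forall>x\<in>F. \<forall>y\<in>F. n \<bullet> (x - y) = 0) \<and> (\<forall>x\<in>T. \<forall>y\<in>F. n \<bullet> (x - y) \<le> 0)"
    using a by (intro exI[of _ "a /\<^sub>R norm a"])
      (auto simp: inner_diff_right mult_le_0_iff)
  from someI_ex[OF this] show ?thesis
    by (simp add: outer_normal_def)
qed

section \<open>Estimates on elements and faces\<close>

text \<open>Lebesgue measure is complete, so measurability passes from \<open>f\<close> to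
  \<open>g\<close> along the almost everywhere equality. This suits integrands such as those with
  \<open>matrix_sqrt (\<kappa> x)\<close>. Extension by zero carries the argument to the whole
  space.\<close>

lemma integral_lebesgue_on_cong_AE:
  fixes f g :: "'a::euclidean_space \<Rightarrow> real"
  assumes S: "S \<in> sets lebesgue" and f: "f \<in> borel_measurable (lebesgue_on S)"
    and ae: "AE x in lebesgue_on S. f x = g x"
  shows "(LINT x|lebesgue_on S. f x) = (LINT x|lebesgue_on S. g x)"
proof -
  have ae': "AE x in lebesgue. (if x \<in> S then f x else 0) = (if x \<in> S then g x else 0)"
    using ae S by (auto simp: AE_restrict_space_iff elim!: eventually_mono)
  have f': "(\<lambda>x. if x \<in> S then f x else 0) \<in> borel_measurable lebesgue"
    using f S by (simp add: borel_measurable_if)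
  have "(LINT x|lebesgue. (if x \<in> S then f x else 0)) = (LINT x|lebesgue. (if x \<in> S then g x else 0))"
    by (rule integral_cong_AE[OF f' borel_measurable_AE[OF f' ae'] ae'])
  then show ?thesis
    using S by (simp add: Lebesgue_Measure.integral_restrict_UNIV)
qed

lemma integrable_lebesgue_on_continuous:
  fixes f :: "'a::euclidean_space \<Rightarrow> real"
  assumes S: "compact S" and f: "continuous_on UNIV f"
  shows "integrable (lebesgue_on S) f"
proof -
  interpret finite_measure "lebesgue_on S"
    by (rule finite_measure_lebesgue_on[OF lmeasurable_compact[OF S]])
  have "compact (f ` S)"
    using S f by (meson compact_continuous_image continuous_on_subset subset_UNIV)
  then obtain C where "\<And>x. x \<in> S \<Longrightarrow> norm (f x) \<le> C"
    by (metis compact_imp_bounded bounded_iff imageI)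
  moreover have "f \<in> borel_measurable (lebesgue_on S)"
    using f by (intro measurable_restrict_space1 measurable_completion)
      (simp add: borel_measurable_continuous_onI)
  ultimately show ?thesis
    by (intro integrable_const_bound[of _ C] AE_I2) simp_all
qed

text \<open>Symmetry and positivity hold only almost everywhere for \<kappa>, but are wanted for one
  matrix. It suffices to find a single point where \<kappa> has both properties and takes its
  constant value on \<open>T\<close>.\<close>

lemma element_tensor:
  fixes M :: "(real^'n) set set"
  assumes "open \<Omega>" and M: "simplicial_mesh \<Omega> M" "T \<in> M"
    and \<kappa>: "diffusion_tensor \<Omega> \<kappa>" "piecewise_constant M \<kappa>"
  shows "AE x in lebesgue_on T. \<kappa> x = element_tensor \<kappa> T"
    and "transpose (element_tensor \<kappa> T) = element_tensor \<kappa> T"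
    and "\<And>\<xi>. 0 \<le> \<xi> \<bullet> (element_tensor \<kappa> T *v \<xi>)"
proof -
  let ?K = "element_tensor \<kappa> T"
  have simpl: "int CARD('n) simplex T" using M by (simp add: simplicial_mesh_def)
  have "\<exists>K. AE x in lebesgue_on T. \<kappa> x = K"
    using \<kappa>(2) M(2) unfolding piecewise_constant_def by blast
  from someI_ex[OF this] show aeT: "AE x in lebesgue_on T. \<kappa> x = ?K"
    unfolding element_tensor_def .
  obtain c where c: "c > 0" "AE x in lebesgue_on \<Omega>. \<forall>\<xi>. c * (norm \<xi>)\<^sup>2 \<le> \<xi> \<bullet> (\<kappa> x *v \<xi>)"
    and sym: "AE x in lebesgue_on \<Omega>. transpose (\<kappa> x) = \<kappa> x"
    using \<kappa>(1) unfolding diffusion_tensor_def by blast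
  have T: "T \<in> sets lebesgue" and \<Omega>: "\<Omega> \<in> sets lebesgue"
    using simpl \<open>open \<Omega>\<close> by (simp_all add: closed_simplex borel_closed)
  have aeU: "AE x in lebesgue. x \<in> T \<inter> \<Omega> \<longrightarrow> \<kappa> x = ?K \<and> transpose (\<kappa> x) = \<kappa> x \<and>
      (\<forall>\<xi>. c * (norm \<xi>)\<^sup>2 \<le> \<xi> \<bullet> (\<kappa> x *v \<xi>))"
  proof -
    have "AE x in lebesgue. x \<in> T \<longrightarrow> \<kappa> x = ?K"
      using aeT T by (simp add: AE_restrict_space_iff)
    moreover have "AE x in lebesgue. x \<in> \<Omega> \<longrightarrow> transpose (\<kappa> x) = \<kappa> x"
      using sym \<Omega> by (simp add: AE_restrict_space_iff)
    moreover have "AE x in lebesgue. x \<in> \<Omega> \<longrightarrow> (\<forall>\<xi>. c * (norm \<xi>)\<^sup>2 \<le> \<xi> \<bullet> (\<kappa> x *v \<xi>))"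
      using c(2) \<Omega> by (simp add: AE_restrict_space_iff)
    ultimately show ?thesis by eventually_elim blast
  qed
  \<comment> \<open>\<open>T\<close> lies only in the closure of \<Omega>, while \<kappa> is
    controlled on \<Omega>. The interior of \<open>T\<close> meets that closure, hence \<Omega>
    itself, so \<open>U\<close> is nonempty and open and cannot be null.\<close>
  define U where "U = interior T \<inter> \<Omega>"
  have "T \<subseteq> closure \<Omega>" using M by (auto simp: simplicial_mesh_def)
  then have "interior T \<inter> closure \<Omega> \<noteq> {}"
    using interior_full_simplex_nonempty[OF simpl] interior_subset[of T] by blast
  then have "U \<noteq> {}"
    unfolding U_def by (simp add: open_Int_closure_eq_empty)
  moreover have "open U" unfolding U_def using \<open>open \<Omega>\<close> by auto
  ultimately have "\<not> negligible U" by (simp add: open_not_negligible)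
  have "\<exists>x\<in>U. \<kappa> x = ?K \<and> transpose (\<kappa> x) = \<kappa> x \<and>
      (\<forall>\<xi>. c * (norm \<xi>)\<^sup>2 \<le> \<xi> \<bullet> (\<kappa> x *v \<xi>))"
  proof (rule ccontr)
    assume *: "\<not> ?thesis"
    have "AE x in lebesgue. x \<notin> U"
      using aeU
    proof eventually_elim
      case (elim x)
      then show ?case using * interior_subset[of T] by (auto simp: U_def)
    qed
    then have "U \<in> null_sets lebesgue"
      by (simp add: completion.null_sets_iff_AE)
    then show False using \<open>\<not> negligible U\<close> by (simp add: negligible_iff_null_sets)
  qed
  then obtain x where x: "\<kappa> x = ?K" "transpose (\<kappa> x) = \<kappa> x"
      "\<And>\<xi>. c * (norm \<xi>)\<^sup>2 \<le> \<xi> \<bullet> (\<kappa> x *v \<xi>)"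
    by blast
  show "transpose ?K = ?K" using x by simp
  show "0 \<le> \<xi> \<bullet> (?K *v \<xi>)" for \<xi>
  proof -
    have "0 \<le> c * (norm \<xi>)\<^sup>2" using c(1) by simp
    also have "\<dots> \<le> \<xi> \<bullet> (?K *v \<xi>)" using x(3)[of \<xi>] x(1) by simp
    finally show ?thesis .
  qed
qed

section \<open>Trace inequality for vector fields and Young's inequality on a face\<close>

lemma norm_power2_vec: "(norm (x :: real^'n))\<^sup>2 = (\<Sum>i\<in>UNIV. (x $ i)\<^sup>2)"
  unfolding power2_norm_eq_inner inner_vec_def by (simp add: power2_eq_square)

lemma matrix_vector_mult_in_polys:
  fixes A :: "real^'n^'m"
  assumes "\<And>i. (\<lambda>x. g x $ i) \<in> polys k"
  shows "(\<lambda>x. (A *v g x) $ i) \<in> polys k"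
  unfolding matrix_vector_mult_def vec_lambda_beta
  by (rule sum_in_polys[OF finite], rule cmult_in_polys, rule assms)

lemma L2_norm_power2: "(L2_norm M f)\<^sup>2 = (LINT x|M. (norm (f x))\<^sup>2)"
  by (simp add: L2_norm_def)

text \<open>The trace constant concerns scalar polynomials. Squaring its inequality and summing over
  components gives the vector version with the same constant.\<close>

lemma trace_vector:
  fixes M :: "(real^'n) set set" and g :: "real^'n \<Rightarrow> real^'m"
  assumes C: "trace_constant k M C" "0 < C"
    and T: "T \<in> M" "F \<in> element_faces M T" "compact T" "compact F" "0 < diameter T"
    and g: "\<And>i. (\<lambda>x. g x $ i) \<in> polys k"
  shows "(LINT x|face_measure F. (norm (g x))\<^sup>2)
    \<le> C\<^sup>2 / diameter T * (LINT x|lebesgue_on T. (norm (g x))\<^sup>2)"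
proof -
  have cont: "continuous_on UNIV (\<lambda>x. (g x $ i)\<^sup>2)" for i
    by (intro continuous_on_power continuous_on_polys[OF g])
  have comp: "(LINT x|face_measure F. (g x $ i)\<^sup>2)
      \<le> C\<^sup>2 / diameter T * (LINT x|lebesgue_on T. (g x $ i)\<^sup>2)" for i
  proof -
    have "L2_norm (face_measure F) (\<lambda>x. g x $ i)
      \<le> C * diameter T powr (-1/2) * L2_norm (lebesgue_on T) (\<lambda>x. g x $ i)"
      using C(1) T(1,2) g[of i] unfolding trace_constant_def by blast
    then have "(L2_norm (face_measure F) (\<lambda>x. g x $ i))\<^sup>2
      \<le> (C * diameter T powr (-1/2) * L2_norm (lebesgue_on T) (\<lambda>x. g x $ i))\<^sup>2"
      by (rule power_mono) (simp add: L2_norm_def)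
    also have "\<dots> = C\<^sup>2 * (diameter T powr (-1/2))\<^sup>2 * (L2_norm (lebesgue_on T) (\<lambda>x. g x $ i))\<^sup>2"
      by (simp only: power_mult_distrib)
    also have "(diameter T powr (-1/2))\<^sup>2 = 1 / diameter T"
      using T(5) by (simp add: powr_powr[symmetric] powr_minus_divide power2_eq_square flip: powr_add)
    finally show ?thesis by (simp add: L2_norm_power2)
  qed
  have "(LINT x|face_measure F. (norm (g x))\<^sup>2) = (\<Sum>i\<in>UNIV. LINT x|face_measure F. (g x $ i)\<^sup>2)"
    unfolding norm_power2_vec
    by (intro Bochner_Integration.integral_sum integrable_face_measure_continuous T cont)
  also have "\<dots> \<le> (\<Sum>i\<in>UNIV. C\<^sup>2 / diameter T * (LINT x|lebesgue_on T. (g x $ i)\<^sup>2))"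
    by (intro sum_mono comp)
  also have "\<dots> = C\<^sup>2 / diameter T * (\<Sum>i\<in>UNIV. LINT x|lebesgue_on T. (g x $ i)\<^sup>2)"
    by (simp only: sum_distrib_left)
  also have "(\<Sum>i\<in>UNIV. LINT x|lebesgue_on T. (g x $ i)\<^sup>2) = (LINT x|lebesgue_on T. (norm (g x))\<^sup>2)"
    unfolding norm_power2_vec
    by (intro Bochner_Integration.integral_sum[symmetric] integrable_lebesgue_on_continuous T cont)
  finally show ?thesis .
qed

text \<open>With \<open>B\<close> the root of \<open>K\<close>, expand the square of
  \<open>X *\<^sub>R w - c *\<^sub>R u\<close> for \<open>u = B *v g\<close> and
  \<open>w = t *\<^sub>R (B *v n)\<close>, divided by \<open>2 * X\<close>. Sharing \<open>K\<close>
  equally between gradient and normal keeps bounds on the eigenvalues of \<open>K\<close> out of the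
  estimate.\<close>

lemma inner_matrix_young:
  fixes K :: "real^'n^'n"
  assumes K: "transpose K = K" "\<And>x. 0 \<le> x \<bullet> (K *v x)" and X: "0 < X"
  shows "c * ((K *v g) \<bullet> (t *\<^sub>R n))
    \<le> X / 2 * (n \<bullet> (K *v n)) * t\<^sup>2 + c\<^sup>2 / (2 * X) * (norm (matrix_sqrt K *v g))\<^sup>2"
proof -
  let ?u = "matrix_sqrt K *v g" and ?w = "t *\<^sub>R (matrix_sqrt K *v n)"
  have "0 \<le> (norm (X *\<^sub>R ?w - c *\<^sub>R ?u))\<^sup>2 / (2 * X)"
    using X by simp
  also have "\<dots> = X / 2 * (?w \<bullet> ?w) + c\<^sup>2 / (2 * X) * (?u \<bullet> ?u) - c * (?u \<bullet> ?w)"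
    unfolding power2_norm_eq_inner inner_diff_left inner_diff_right inner_scaleR_left inner_scaleR_right
    using X by (simp add: field_simps power2_eq_square inner_commute)
  also have "?u \<bullet> ?w = (K *v g) \<bullet> (t *\<^sub>R n)"
    by (simp add: inner_matrix_sqrt[OF K])
  also have "?w \<bullet> ?w = (n \<bullet> (K *v n)) * t\<^sup>2"
    by (simp add: inner_matrix_sqrt[OF K] power2_eq_square inner_commute)
  finally show ?thesis by (simp add: power2_norm_eq_inner mult.assoc)
qed

lemma face_young:
  fixes K :: "real^'n^'n"
  assumes K: "transpose K = K" "\<And>x. 0 \<le> x \<bullet> (K *v x)" and X: "0 < X"
    and F: "compact F" and g: "\<And>i. (\<lambda>x. g x $ i) \<in> polys k"
    and j: "integrable (face_measure F) (\<lambda>x. (j x)\<^sup>2)"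
  shows "c * (LINT x|face_measure F. (K *v g x) \<bullet> (j x *\<^sub>R n))
    \<le> X / 2 * (n \<bullet> (K *v n)) * (LINT x|face_measure F. (j x)\<^sup>2)
      + c\<^sup>2 / (2 * X) * (LINT x|face_measure F. (norm (matrix_sqrt K *v g x))\<^sup>2)"
proof -
  have int: "integrable (face_measure F) (\<lambda>x. (norm (matrix_sqrt K *v g x))\<^sup>2)"
    unfolding norm_power2_vec
    by (intro integrable_face_measure_continuous F continuous_on_sum continuous_on_power
        continuous_on_polys[OF matrix_vector_mult_in_polys[OF g]])
  have "c * (LINT x|face_measure F. (K *v g x) \<bullet> (j x *\<^sub>R n))
      = (LINT x|face_measure F. c * ((K *v g x) \<bullet> (j x *\<^sub>R n)))"
    by simp
  also have "\<dots> \<le> (LINT x|face_measure F. X / 2 * (n \<bullet> (K *v n)) * (j x)\<^sup>2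
      + c\<^sup>2 / (2 * X) * (norm (matrix_sqrt K *v g x))\<^sup>2)"
  \<comment> \<open>This rule asks for integrability of the dominating function alone. Its
    nonnegativity covers the case where the left integral takes the default value 0.\<close>
  proof (rule integral_mono')
    show "integrable (face_measure F) (\<lambda>x. X / 2 * (n \<bullet> (K *v n)) * (j x)\<^sup>2
      + c\<^sup>2 / (2 * X) * (norm (matrix_sqrt K *v g x))\<^sup>2)"
      by (intro Bochner_Integration.integrable_add integrable_mult_right j int)
    show "0 \<le> X / 2 * (n \<bullet> (K *v n)) * (j x)\<^sup>2
      + c\<^sup>2 / (2 * X) * (norm (matrix_sqrt K *v g x))\<^sup>2" for x
      using X K(2)[of n] by (intro add_nonneg_nonneg mult_nonneg_nonneg) simp_all
  qed (rule inner_matrix_young[OF K X])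
  also have "\<dots> = X / 2 * (n \<bullet> (K *v n)) * (LINT x|face_measure F. (j x)\<^sup>2)
      + c\<^sup>2 / (2 * X) * (LINT x|face_measure F. (norm (matrix_sqrt K *v g x))\<^sup>2)"
    using j int by simp
  finally show ?thesis .
qed

text \<open>The sign of \<delta> decides whether the power increases or decreases, hence whether the
  upper or the lower bound on \<open>d\<close> is used. The maximum covers both cases.\<close>

lemma powr_quasi_uniform_le:
  fixes d h \<rho> \<delta> :: real
  assumes "0 < \<rho>" "0 < h" "\<rho> * h \<le> d" "d \<le> h"
  shows "d powr \<delta> \<le> max 1 (\<rho> powr \<delta>) * h powr \<delta>"
proof (cases "0 \<le> \<delta>")
  case True
  have "0 < d" using assms by (smt (verit) mult_pos_pos)
  then have "d powr \<delta> \<le> h powr \<delta>"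
    using True assms by (intro powr_mono2) auto
  also have "\<dots> \<le> max 1 (\<rho> powr \<delta>) * h powr \<delta>"
    using mult_right_mono[of 1 "max 1 (\<rho> powr \<delta>)" "h powr \<delta>"] by simp
  finally show ?thesis .
next
  case False
  have "d powr \<delta> \<le> (\<rho> * h) powr \<delta>"
    using False assms by (intro powr_mono2') auto
  also have "\<dots> = \<rho> powr \<delta> * h powr \<delta>"
    using assms by (simp add: powr_mult)
  also have "\<dots> \<le> max 1 (\<rho> powr \<delta>) * h powr \<delta>"
    by (intro mult_right_mono) auto
  finally show ?thesis .
qed

text \<open>Each face uses half of its own penalty term and a share \<open>e\<close> of the volume
  energy \<open>a\<close>. The hypothesis on \<alpha> makes \<open>N\<close> such shares at most one
  half.\<close>

lemma element_coercive:
  fixes M :: "(real^'n) set set" and K :: "real^'n^'n" and g :: "real^'n \<Rightarrow> real^'n"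
    and j :: "(real^'n) set \<Rightarrow> real^'n \<Rightarrow> real" and n :: "(real^'n) set \<Rightarrow> real^'n"
  assumes C: "trace_constant k M C" "0 < C"
    and T: "T \<in> M" "compact T" "0 < diameter T"
    and F: "\<And>F. F \<in> element_faces M T \<Longrightarrow> compact F" "card (element_faces M T) \<le> N"
    and K: "transpose K = K" "\<And>x. 0 \<le> x \<bullet> (K *v x)"
    and g: "\<And>i. (\<lambda>x. g x $ i) \<in> polys k"
    and j: "\<And>F. F \<in> element_faces M T \<Longrightarrow> integrable (face_measure F) (\<lambda>x. (j F x)\<^sup>2)"
    and \<alpha>: "0 < \<alpha>" "c\<^sup>2 * real N * diameter T powr \<delta> \<le> \<alpha>"
  shows "c * (\<Sum>F\<in>element_faces M T. LINT x|face_measure F. (K *v g x) \<bullet> (j F x *\<^sub>R n F))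
    \<le> 1/2 * (\<Sum>F\<in>element_faces M T.
          \<alpha> * C\<^sup>2 * (n F \<bullet> (K *v n F)) / diameter T powr (1 + \<delta>) * (LINT x|face_measure F. (j F x)\<^sup>2))
      + 1/2 * (LINT x|lebesgue_on T. (norm (matrix_sqrt K *v g x))\<^sup>2)"
proof -
  define a where "a = (LINT x|lebesgue_on T. (norm (matrix_sqrt K *v g x))\<^sup>2)"
  \<comment> \<open>The penalty is \<open>X\<close> times \<open>n F \<bullet> (K *v n F)\<close>. Weighting Young's inequality with \<open>X\<close> avoids
    a division by the second factor.\<close>
  define X where "X = \<alpha> * C\<^sup>2 / diameter T powr (1 + \<delta>)"
  define P where "P F = X * (n F \<bullet> (K *v n F)) * (LINT x|face_measure F. (j F x)\<^sup>2)" for F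
  \<comment> \<open>Product of the Young factor \<open>c\<^sup>2 / (2 * X)\<close> and the trace
    factor \<open>C\<^sup>2 / diameter T\<close>: the trace constant cancels, and one power of the
    diameter does too.\<close>
  define e where "e = c\<^sup>2 * diameter T powr \<delta> / (2 * \<alpha>)"
  have X: "X > 0" using \<alpha>(1) C(2) T(3) by (simp add: X_def)
  have a: "a \<ge> 0" unfolding a_def by (rule Bochner_Integration.integral_nonneg) simp
  have e: "e \<ge> 0" using \<alpha>(1) by (simp add: e_def)
  have "c * (LINT x|face_measure F. (K *v g x) \<bullet> (j F x *\<^sub>R n F)) \<le> 1/2 * P F + e * a"
    if "F \<in> element_faces M T" for F
  proof -
    let ?I = "LINT x|face_measure F. (norm (matrix_sqrt K *v g x))\<^sup>2"
    have "c * (LINT x|face_measure F. (K *v g x) \<bullet> (j F x *\<^sub>R n F))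
        \<le> X / 2 * (n F \<bullet> (K *v n F)) * (LINT x|face_measure F. (j F x)\<^sup>2) + c\<^sup>2 / (2 * X) * ?I"
      by (rule face_young[OF K X F(1)[OF that] g j[OF that]])
    also have "c\<^sup>2 / (2 * X) * ?I \<le> c\<^sup>2 / (2 * X) * (C\<^sup>2 / diameter T * a)"
      unfolding a_def using X
      by (intro mult_left_mono trace_vector[OF C T(1) that T(2) F(1)[OF that] T(3)]
          matrix_vector_mult_in_polys g) simp
    also have "c\<^sup>2 / (2 * X) * (C\<^sup>2 / diameter T * a) = e * a"
      using C(2) T(3) \<alpha>(1) by (simp add: X_def e_def powr_add field_simps)
    finally show ?thesis by (simp add: P_def)
  qed
  then have "(\<Sum>F\<in>element_faces M T. c * (LINT x|face_measure F. (K *v g x) \<bullet> (j F x *\<^sub>R n F)))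
      \<le> (\<Sum>F\<in>element_faces M T. 1/2 * P F + e * a)"
    by (rule sum_mono)
  also have "\<dots> = 1/2 * (\<Sum>F\<in>element_faces M T. P F) + card (element_faces M T) * (e * a)"
    by (simp add: sum.distrib sum_divide_distrib)
  also have "card (element_faces M T) * (e * a) \<le> N * (e * a)"
    using F(2) a e by (intro mult_right_mono) auto
  also have "N * (e * a) = (N * e) * a" by simp
  also have "(N * e) * a \<le> 1/2 * a"
    using \<alpha> a by (intro mult_right_mono) (simp_all add: e_def field_simps)
  finally have "c * (\<Sum>F\<in>element_faces M T. LINT x|face_measure F. (K *v g x) \<bullet> (j F x *\<^sub>R n F))
      \<le> 1/2 * (\<Sum>F\<in>element_faces M T. P F) + 1/2 * a"
    by (simp only: sum_distrib_left)
  moreover have "P F = \<alpha> * C\<^sup>2 * (n F \<bullet> (K *v n F)) / diameter T powr (1 + \<delta>)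
      * (LINT x|face_measure F. (j F x)\<^sup>2)" for F
    by (simp add: P_def X_def)
  ultimately show ?thesis by (simp only: a_def)
qed

section \<open>Discrete functions and the global estimate\<close>

lemma element_poly_in_polys:
  assumes "v \<in> V_elem \<Omega> M k" "T \<in> M"
  shows "element_poly k v T \<in> polys k"
proof -
  have "\<exists>p. p \<in> polys k \<and> (AE x in lebesgue_on T. v x = p x)"
    using assms unfolding V_elem_def by blast
  from someI_ex[OF this] show ?thesis
    unfolding element_poly_def by blast
qed

lemma compact_facet: "compact T \<Longrightarrow> convex T \<Longrightarrow> F facet_of T \<Longrightarrow> compact F"
  by (meson compact_Int_closed face_of_imp_compact facet_of_imp_face_of)

text \<open>Bounded by twice the sum of the squares. It makes the jump, a polynomial minus the face
  unknown, square integrable.\<close>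

lemma integrable_power2_diff:
  fixes f g :: "'a \<Rightarrow> real"
  assumes [measurable]: "f \<in> borel_measurable M" "g \<in> borel_measurable M"
    and f: "integrable M (\<lambda>x. (f x)\<^sup>2)" and g: "integrable M (\<lambda>x. (g x)\<^sup>2)"
  shows "integrable M (\<lambda>x. (f x - g x)\<^sup>2)"
proof (rule Bochner_Integration.integrable_bound)
  show "integrable M (\<lambda>x. 2 * (f x)\<^sup>2 + 2 * (g x)\<^sup>2)"
    using f g by simp
  have "(f x - g x)\<^sup>2 \<le> 2 * (f x)\<^sup>2 + 2 * (g x)\<^sup>2" for x
    using zero_le_power2[of "f x + g x"] by (simp add: power2_eq_square algebra_simps)
  then show "AE x in M. norm ((f x - g x)\<^sup>2) \<le> norm (2 * (f x)\<^sup>2 + 2 * (g x)\<^sup>2)"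
    by (intro AE_I2) simp
qed simp

theorem lemma3p3:
  fixes \<Omega> :: "(real^'n) set" and H :: "real set" and \<T> :: "real \<Rightarrow> (real^'n) set set"
    and \<rho>\<^sub>0 C\<^sub>t\<^sub>r \<epsilon> \<delta> :: real and k :: nat
  assumes "2 \<le> CARD('n)"
    and "polyhedral_lipschitz_domain \<Omega>"
    and "mesh_family \<Omega> H \<T>"
    and "0 < \<rho>\<^sub>0" and "\<rho>\<^sub>0 \<le> 1" and "quasi_uniform \<rho>\<^sub>0 H \<T>"
    and "0 < C\<^sub>t\<^sub>r" and "\<forall>h\<in>H. trace_constant k (\<T> h) C\<^sub>t\<^sub>r"
    and "\<epsilon> \<in> {0, 1, -1}"
  shows "\<exists>C\<^sub>\<epsilon>\<ge>0. (C\<^sub>\<epsilon> = 0 \<longleftrightarrow> \<epsilon> = -1) \<and>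
    (\<forall>\<kappa>. diffusion_tensor \<Omega> \<kappa> \<and> (\<forall>h\<in>H. piecewise_constant (\<T> h) \<kappa>) \<longrightarrow>
      (\<forall>h\<in>H. \<forall>\<alpha>\<^sub>0>0. \<alpha>\<^sub>0 > C\<^sub>\<epsilon> * h powr \<delta> \<longrightarrow>
        (\<forall>v\<in>V_space \<Omega> (\<T> h) k.
           bilinear_form k \<epsilon> \<alpha>\<^sub>0 C\<^sub>t\<^sub>r \<delta> \<kappa> (\<T> h) v v
             \<ge> 1/2 * (star_norm k \<alpha>\<^sub>0 C\<^sub>t\<^sub>r \<delta> \<kappa> (\<T> h) v)\<^sup>2)))"
proof -
  define N :: nat where "N = 2 ^ (CARD('n) + 1)"
  define Ce where "Ce = (1 + \<epsilon>)\<^sup>2 * real N * max 1 (\<rho>\<^sub>0 powr \<delta>)"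
  have "0 \<le> Ce"
    by (simp add: Ce_def)
  \<comment> \<open>The other two factors of \<open>Ce\<close> are at least 1, so only
    \<open>1 + \<epsilon>\<close> can vanish.\<close>
  moreover have "Ce = 0 \<longleftrightarrow> \<epsilon> = -1"
    by (auto simp: Ce_def N_def max_def)
  moreover have "bilinear_form k \<epsilon> \<alpha> C\<^sub>t\<^sub>r \<delta> \<kappa> (\<T> h) v v
      \<ge> 1/2 * (star_norm k \<alpha> C\<^sub>t\<^sub>r \<delta> \<kappa> (\<T> h) v)\<^sup>2"
    if \<kappa>: "diffusion_tensor \<Omega> \<kappa>" "\<forall>h\<in>H. piecewise_constant (\<T> h) \<kappa>"
      and h: "h \<in> H" and \<alpha>: "0 < \<alpha>" "Ce * h powr \<delta> < \<alpha>" and v: "v \<in> V_space \<Omega> (\<T> h) k"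
    for \<kappa> h \<alpha> v
  proof -
    define M where "M = \<T> h"
    define G where "G T = broken_gradient k (fst v) T" for T
    define K where "K T = element_tensor \<kappa> T" for T
    define n where "n T F = outer_normal T F" for T F :: "(real^'n) set"
    define j where "j T F x = element_poly k (fst v) T x - snd v x" for T F :: "(real^'n) set" and x
    define \<tau> where "\<tau> T F = penalty \<alpha> C\<^sub>t\<^sub>r \<delta> \<kappa> T F" for T F
    define a where "a T = (LINT x|lebesgue_on T. (norm (matrix_sqrt (K T) *v G T x))\<^sup>2)" for T
    define b where "b T F = (LINT x|face_measure F. (K T *v G T x) \<bullet> (j T F x *\<^sub>R n T F))" for T F
    define p where "p T F = \<tau> T F * (LINT x|face_measure F. (j T F x)\<^sup>2)" for T F
    have mesh: "simplicial_mesh \<Omega> M" and h0: "0 < h"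
      using assms(3) h by (auto simp: mesh_family_def M_def)
    have "open \<Omega>" using assms(2) by (simp add: polyhedral_lipschitz_domain_def)
    have simpl: "int CARD('n) simplex T" if "T \<in> M" for T
      using mesh that by (simp add: simplicial_mesh_def)
    note compT = compact_simplex[OF simpl]
    note K = element_tensor[OF \<open>open \<Omega>\<close> mesh _ \<kappa>(1) \<kappa>(2)[rule_format, OF h, folded M_def], folded K_def]
    have diam: "\<rho>\<^sub>0 * h \<le> diameter T" "diameter T \<le> h" if "T \<in> M" for T
      using assms(6) h that by (auto simp: quasi_uniform_def M_def)
    have diam0: "0 < diameter T" if "T \<in> M" for T
      using diam(1)[OF that] mult_pos_pos[OF assms(4) h0] by linarith
    have poly: "element_poly k (fst v) T \<in> polys k" if "T \<in> M" for T
      using v that by (intro element_poly_in_polys) (auto simp: V_space_def M_def)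
    have G: "(\<lambda>x. G T x $ i) \<in> polys k" if "T \<in> M" for T i
      unfolding G_def broken_gradient_def by (rule gradient_in_polys[OF poly[OF that]])
    have facet: "F facet_of T" if "T \<in> M" "F \<in> element_faces M T" for T F
      by (rule element_faces_facet_of[OF mesh that])
    have compF: "compact F" if "T \<in> M" "F \<in> element_faces M T" for T F
      by (rule compact_facet[OF compT convex_simplex[OF simpl] facet]) (use that in simp_all)
    have n1: "norm (n T F) = 1" if "T \<in> M" "F \<in> element_faces M T" for T F
      unfolding n_def by (rule norm_outer_normal[OF simplex_imp_polyhedron[OF simpl] facet])
        (use that in simp_all)
    have j2: "integrable (face_measure F) (\<lambda>x. (j T F x)\<^sup>2)"
      if "T \<in> M" "F \<in> element_faces M T" for T F
    proof -
      have "F \<in> faces (\<T> h)" using that(2) by (simp add: element_faces_def M_def)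
      then have "snd v \<in> L2 (face_measure F)"
        using v by (auto simp: V_space_def V_face_def)
      then have u: "snd v \<in> borel_measurable (face_measure F)"
          "integrable (face_measure F) (\<lambda>x. (snd v x)\<^sup>2)"
        by (simp_all add: L2_def)
      show ?thesis
        unfolding j_def
        by (intro integrable_power2_diff u integrable_face_measure_continuous compF[OF that]
            continuous_on_power continuous_on_polys[OF poly[OF that(1)]]
            borel_measurable_face_measure[OF borel_measurable_continuous_onI])
    qed
    have \<tau>0: "0 \<le> \<tau> T F" if "T \<in> M" for T F
      using K(3)[OF that] \<alpha>(1) by (simp add: \<tau>_def penalty_def K_def)
    \<comment> \<open>Form and norm evaluate \<kappa> pointwise. Almost everywhere on
      \<open>T\<close> it equals \<open>K T\<close>, so both volume terms become
      \<open>a T\<close>.\<close>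
    have vol: "(LINT x|lebesgue_on T. (\<kappa> x *v G T x) \<bullet> G T x) = a T"
      and vol_norm: "(L2_norm (lebesgue_on T) (\<lambda>x. matrix_sqrt (\<kappa> x) *v G T x))\<^sup>2 = a T"
      if T: "T \<in> M" for T
    proof -
      have "integrable (lebesgue_on T) (\<lambda>x. (norm (matrix_sqrt (K T) *v G T x))\<^sup>2)"
        unfolding norm_power2_vec
        by (intro integrable_lebesgue_on_continuous compT[OF T] continuous_on_sum continuous_on_power
            continuous_on_polys[OF matrix_vector_mult_in_polys[OF G[OF T]]])
      then have meas: "(\<lambda>x. (norm (matrix_sqrt (K T) *v G T x))\<^sup>2) \<in> borel_measurable (lebesgue_on T)"
        by (rule borel_measurable_integrable)
      have Tl: "T \<in> sets lebesgue"
        using compT[OF T] by (simp add: borel_compact)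
      show "(LINT x|lebesgue_on T. (\<kappa> x *v G T x) \<bullet> G T x) = a T"
        unfolding a_def
      proof (rule integral_lebesgue_on_cong_AE[OF Tl meas, symmetric])
        show "AE x in lebesgue_on T. (norm (matrix_sqrt (K T) *v G T x))\<^sup>2 = (\<kappa> x *v G T x) \<bullet> G T x"
          using K(1)[OF T] by eventually_elim
            (simp add: power2_norm_eq_inner inner_matrix_sqrt[OF K(2)[OF T] K(3)[OF T]])
      qed
      show "(L2_norm (lebesgue_on T) (\<lambda>x. matrix_sqrt (\<kappa> x) *v G T x))\<^sup>2 = a T"
        unfolding a_def L2_norm_power2
      proof (rule integral_lebesgue_on_cong_AE[OF Tl meas, symmetric])
        show "AE x in lebesgue_on T. (norm (matrix_sqrt (K T) *v G T x))\<^sup>2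
            = (norm (matrix_sqrt (\<kappa> x) *v G T x))\<^sup>2"
          using K(1)[OF T] by eventually_elim simp
      qed
    qed
    have jump: "jump k v T F x = j T F x *\<^sub>R n T F" for T F x
      by (simp add: jump_def j_def n_def)
    \<comment> \<open>The normal has length 1, which reduces vector jumps to scalar ones; in the
      norm, the square of \<open>sqrt (\<tau> T F)\<close> gives back the penalty because that is
      nonnegative.\<close>
    have pen: "(LINT x|face_measure F. (\<tau> T F *\<^sub>R jump k v T F x) \<bullet> jump k v T F x) = p T F"
      and pen_norm: "(L2_norm (face_measure F) (\<lambda>x. sqrt (\<tau> T F) *\<^sub>R jump k v T F x))\<^sup>2 = p T F"
      if T: "T \<in> M" "F \<in> element_faces M T" for T F
    proof -
      have "n T F \<bullet> n T F = 1" using n1[OF T] by (simp add: norm_eq_1)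
      then have *: "(\<tau> T F *\<^sub>R jump k v T F x) \<bullet> jump k v T F x = \<tau> T F * (j T F x)\<^sup>2" for x
        by (simp add: jump power2_eq_square)
      then show "(LINT x|face_measure F. (\<tau> T F *\<^sub>R jump k v T F x) \<bullet> jump k v T F x) = p T F"
        unfolding * p_def by simp
      have "(norm (sqrt (\<tau> T F) *\<^sub>R jump k v T F x))\<^sup>2 = \<tau> T F * (j T F x)\<^sup>2" for x
        using \<tau>0[OF T(1)] n1[OF T] by (simp add: jump power_mult_distrib)
      then show "(L2_norm (face_measure F) (\<lambda>x. sqrt (\<tau> T F) *\<^sub>R jump k v T F x))\<^sup>2 = p T F"
        by (simp add: L2_norm_power2 p_def)
    qed
    have b: "b T F = (LINT x|face_measure F. (K T *v G T x) \<bullet> jump k v T F x)" for T F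
      by (simp only: b_def jump)
    \<comment> \<open>On the diagonal the two coupling terms are the same number, which yields the
      factor \<open>1 + \<epsilon>\<close>.\<close>
    have bil: "bilinear_form k \<epsilon> \<alpha> C\<^sub>t\<^sub>r \<delta> \<kappa> M v v
      = (\<Sum>T\<in>M. a T) + (\<Sum>T\<in>M. \<Sum>F\<in>element_faces M T. p T F)
        - (1 + \<epsilon>) * (\<Sum>T\<in>M. \<Sum>F\<in>element_faces M T. b T F)"
      unfolding bilinear_form_def G_def[symmetric] \<tau>_def[symmetric] K_def[symmetric]
      by (simp add: vol pen b[symmetric] distrib_right del: inner_scaleR_left cong: sum.cong)
    have "0 \<le> a T" for T
      unfolding a_def by (rule Bochner_Integration.integral_nonneg) simp
    moreover have "0 \<le> p T F" if "T \<in> M" for T F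
      unfolding p_def using \<tau>0[OF that]
      by (intro mult_nonneg_nonneg Bochner_Integration.integral_nonneg) simp_all
    \<comment> \<open>Nonnegative summands allow the square to cancel the root in
      \<open>star_norm\<close>.\<close>
    ultimately have star: "(star_norm k \<alpha> C\<^sub>t\<^sub>r \<delta> \<kappa> M v)\<^sup>2
      = (\<Sum>T\<in>M. a T) + (\<Sum>T\<in>M. \<Sum>F\<in>element_faces M T. p T F)"
      unfolding star_norm_def G_def[symmetric] \<tau>_def[symmetric]
      by (simp add: vol_norm pen_norm sum_nonneg cong: sum.cong)
    have "(1 + \<epsilon>) * (\<Sum>F\<in>element_faces M T. b T F)
        \<le> 1/2 * (\<Sum>F\<in>element_faces M T. p T F) + 1/2 * a T" if T: "T \<in> M" for T
    proof -
      \<comment> \<open>Quasi-uniformity turns the threshold in the global mesh size into the bound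
        in the local diameter that \<open>element_coercive\<close> expects.\<close>
      have "(1 + \<epsilon>)\<^sup>2 * real N * diameter T powr \<delta>
          \<le> (1 + \<epsilon>)\<^sup>2 * real N * (max 1 (\<rho>\<^sub>0 powr \<delta>) * h powr \<delta>)"
        by (intro mult_left_mono powr_quasi_uniform_le[OF assms(4) h0 diam[OF T]]) simp
      also have "\<dots> \<le> \<alpha>"
        using \<alpha>(2) by (simp add: Ce_def mult.assoc)
      finally have *: "(1 + \<epsilon>)\<^sup>2 * real N * diameter T powr \<delta> \<le> \<alpha>" .
      have tr: "trace_constant k M C\<^sub>t\<^sub>r"
        using assms(8) h by (simp add: M_def)
      show ?thesis
        unfolding a_def b_def p_def \<tau>_def penalty_def K_def[symmetric] n_def[symmetric]
        by (rule element_coercive[OF tr assms(7) T compT[OF T] diam0[OF T] compF[OF T]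
              card_element_faces[OF mesh T, folded N_def] K(2)[OF T] K(3)[OF T] G[OF T] j2[OF T] \<alpha>(1) *])
    qed
    then have "(\<Sum>T\<in>M. (1 + \<epsilon>) * (\<Sum>F\<in>element_faces M T. b T F))
        \<le> (\<Sum>T\<in>M. 1/2 * (\<Sum>F\<in>element_faces M T. p T F) + 1/2 * a T)"
      by (rule sum_mono)
    then have "(1 + \<epsilon>) * (\<Sum>T\<in>M. \<Sum>F\<in>element_faces M T. b T F)
        \<le> 1/2 * (\<Sum>T\<in>M. \<Sum>F\<in>element_faces M T. p T F) + 1/2 * (\<Sum>T\<in>M. a T)"
      by (simp only: sum_distrib_left sum.distrib)
    \<comment> \<open>The coupling term consumes at most half of the volume and penalty terms, whose
      sum is the squared norm.\<close>
    then show ?thesis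
      using bil star unfolding M_def by (simp only:) argo
  qed
  ultimately show ?thesis
    by blast
qed

end
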